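(* Define binary words $X_{-2}=X_{-1}=X_0=0$ and $X_n=X_{n-1}\overline{X_{n-3}}$ for $n\ge1$, where $\overline{\cdot}$ is the letter-wise complement $0\leftrightarrow1$, and let ${\bf aj}={\bf aj}[0]{\bf aj}[1]\cdots$ be the limit of $(X_n)$. For $i\in\{0,1\}$ let $J_i=\{n\ge0:{\bf aj}[n]=i\}$. Then every integer $\ge10$ is a sum of two (not necessarily distinct) elements of $J_0$, and every integer $\ge2$ is a sum of two (not necessarily distinct) elements of $J_1$. *)

theory Defs
  imports Main
begin

definition compl_word :: "nat list \<Rightarrow> nat list" where
  "compl_word w = map (\<lambda>c. 1 - c) w"

text \<open>The index is shifted by two: \<open>ajX k\<close> is the word \<open>X\<^bsub>k - 2\<^esub>\<close>,
  so that the three initial words are \<open>ajX 0\<close>, \<open>ajX 1\<close>, \<open>ajX 2\<close>.\<close>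

fun ajX :: "nat \<Rightarrow> nat list" where
  "ajX 0 = [0]"
| "ajX (Suc 0) = [0]"
| "ajX (Suc (Suc 0)) = [0]"
| "ajX (Suc (Suc (Suc k))) = ajX (Suc (Suc k)) @ compl_word (ajX k)"

definition aj :: "nat \<Rightarrow> nat" where
  "aj n = (THE c. \<forall>\<^sub>F k in sequentially. n < length (ajX k) \<and> ajX k ! n = c)"

definition J :: "nat \<Rightarrow> nat set" where
  "J i = {n. aj n = i}"

text \<open>The limit exists: every \<open>ajX k\<close> is a prefix of the infinite word \<open>aj\<close>,
  and the lengths are unbounded.\<close>

lemma length_ajX_gt: "n < length (ajX (n + 2))"
proof (induction n)
  case (Suc n)
  have "length (ajX k) > 0" for k
    by (induction k rule: ajX.induct) auto
  from this[of n] have "length (ajX (Suc n + 2)) > length (ajX (n + 2))"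
    by (simp add: compl_word_def)
  with Suc show ?case by linarith
qed simp

lemma ajX_prefix: "\<exists>w. ajX (k + m) = ajX k @ w"
proof (induction m)
  case (Suc m)
  have "\<exists>w. ajX (Suc j) = ajX j @ w" for j
    by (cases j rule: ajX.cases) auto
  then show ?case using Suc by (metis add_Suc_right append.assoc)
qed simp

lemma aj_eq_ajX_nth:
  assumes "n < length (ajX k)"
  shows "aj n = ajX k ! n"
proof -
  have "n < length (ajX j) \<and> ajX j ! n = ajX k ! n" if "j \<ge> k" for j
    using ajX_prefix[of k "j - k"] that assms by (auto simp: nth_append)
  then have ev: "\<forall>\<^sub>F j in sequentially. n < length (ajX j) \<and> ajX j ! n = ajX k ! n"
    unfolding eventually_sequentially by blast
  show ?thesis unfolding aj_def
  proof (rule the_equality)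
    fix c assume "\<forall>\<^sub>F j in sequentially. n < length (ajX j) \<and> ajX j ! n = c"
    with ev have "\<forall>\<^sub>F j in sequentially. c = ajX k ! n"
      by eventually_elim simp
    then show "c = ajX k ! n" by simp
  qed (rule ev)
qed

end

theory Submission
  imports Defs
begin

text \<open>
  A bounded summand suffices: for every \<open>n \<ge> 16\<close>, all four pairs of bits occur among
  \<open>(aj a, aj (n - a))\<close> with \<open>a \<le> 16\<close>. This only depends on the window of
  \<open>aj\<close> of length 17 ending at \<open>n\<close>, up to complement. Write \<open>L k\<close> for the length of
  \<open>ajX k\<close> and let \<open>n = L (k + 2) + j\<close> with \<open>j < L k\<close>. If \<open>j \<ge> 16\<close>,
  the window at \<open>n\<close> is the complement of the window at \<open>j\<close>. If \<open>j < 16\<close>, it straddles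
  the border at \<open>L (k + 2)\<close>; since the last 16 letters of \<open>ajX (k + 3)\<close> and \<open>ajX k\<close> are complementary,
  the window coincides with the one at \<open>L (k - 4) + j\<close>. Thus all windows reduce to the
  finitely many with \<open>n < L 17 = 406\<close>.
\<close>

lemma length_ajX_Suc3: "length (ajX (k + 3)) = length (ajX (k + 2)) + length (ajX k)"
  by (simp add: compl_word_def numeral_eq_Suc)

lemma length_ajX_mono: "k \<le> m \<Longrightarrow> length (ajX k) \<le> length (ajX m)"
  using ajX_prefix[of k "m - k"] by auto

lemma aj_shift:
  assumes "j < length (ajX k)"
  shows "aj (length (ajX (k + 2)) + j) = 1 - aj j"
proof -
  have "aj (length (ajX (k + 2)) + j) = ajX (k + 3) ! (length (ajX (k + 2)) + j)"
    using assms by (intro aj_eq_ajX_nth) (simp add: length_ajX_Suc3)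
  also have "\<dots> = 1 - ajX k ! j"
    using assms by (simp add: numeral_eq_Suc compl_word_def nth_append)
  finally show ?thesis using aj_eq_ajX_nth[OF assms] by simp
qed

lemma aj_before_border:
  assumes "0 < t" "t \<le> length (ajX k)"
  shows "aj (length (ajX (k + 3)) - t) = 1 - aj (length (ajX k) - t)"
  using aj_shift[of "length (ajX k) - t" k] assms by (simp add: length_ajX_Suc3)

lemma ajX_le_1: "c \<in> set (ajX k) \<Longrightarrow> c \<le> 1"
  by (induction k arbitrary: c rule: ajX.induct) (auto simp: compl_word_def)

lemma aj_le_1: "aj n \<le> 1"
  using aj_eq_ajX_nth[OF length_ajX_gt] ajX_le_1 nth_mem[OF length_ajX_gt] by metis

text \<open>Raising the index by 6 complements twice. The two complements cancel in truncated
  subtraction because letters are at most 1.\<close>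

lemma aj_before_border_period:
  assumes "0 < t" "t \<le> length (ajX k)"
  shows "aj (length (ajX (k + 6)) - t) = aj (length (ajX k) - t)"
proof -
  have "aj (length (ajX (k + 3 + 3)) - t) = 1 - aj (length (ajX (k + 3)) - t)"
    using assms length_ajX_mono[of k "k + 3"] by (intro aj_before_border) auto
  then show ?thesis
    using aj_before_border[OF assms] aj_le_1[of "length (ajX k) - t"]
    by (simp add: add.assoc)
qed

text \<open>Asking for all four pairs makes the property stable under complementing the window,
  since flipping the second bit permutes them; (0, 0) and (1, 1) alone would turn into (0, 1) and
  (1, 0).\<close>

definition all_pairs :: "nat \<Rightarrow> bool" where
  "all_pairs n \<longleftrightarrow> {(0, 0), (0, 1), (1, 0), (1, 1)} \<subseteq> (\<lambda>a. (aj a, aj (n - a))) ` {..16}"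

lemma all_pairs_cong:
  assumes "\<And>a. a \<le> 16 \<Longrightarrow> aj (n - a) = aj (m - a)" "all_pairs m"
  shows "all_pairs n"
proof -
  have "(\<lambda>a. (aj a, aj (n - a))) ` {..16} = (\<lambda>a. (aj a, aj (m - a))) ` {..16}"
    using assms(1) by (intro image_cong) auto
  then show ?thesis using assms(2) by (simp add: all_pairs_def)
qed

lemma all_pairs_compl:
  assumes "\<And>a. a \<le> 16 \<Longrightarrow> aj (n - a) = 1 - aj (m - a)" "all_pairs m"
  shows "all_pairs n"
proof -
  have "(x, y) \<in> (\<lambda>a. (aj a, aj (n - a))) ` {..16}" if "x \<in> {0, 1}" "y \<in> {0, 1}" for x y
  proof -
    have "(x, 1 - y) \<in> (\<lambda>a. (aj a, aj (m - a))) ` {..16}"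
      using assms(2) that unfolding all_pairs_def by auto
    then obtain a where "a \<le> 16" "aj a = x" "aj (m - a) = 1 - y" by auto
    moreover have "y = 1 - (1 - y)" using that by auto
    ultimately show ?thesis using assms(1)[of a] by force
  qed
  then show ?thesis unfolding all_pairs_def by blast
qed

text \<open>Index 9 is the first whose word has at least 17 letters, hence contains
  \<open>aj 0\<close> to \<open>aj 16\<close>.\<close>

lemma ajX_9: "ajX 9 = [0,1,1,1,1,0,1,0,0,1,0,0,0,1,0,0,0,0,1]"
  by (simp add: numeral_eq_Suc compl_word_def)

lemma length_ajX_17: "length (ajX 17) = 406"
  by code_simp

text \<open>Stepping with \<open>tl\<close> checks all windows in one pass by evaluation;
  \<open>zip\<close> cuts each suffix down to the length of \<open>r\<close>.\<close>

primrec windows_cover :: "nat list \<Rightarrow> nat \<Rightarrow> nat list \<Rightarrow> bool" where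
  "windows_cover r 0 xs \<longleftrightarrow> True"
| "windows_cover r (Suc m) xs \<longleftrightarrow>
    {(0, 0), (0, 1), (1, 0), (1, 1)} \<subseteq> set (zip r xs) \<and> windows_cover r m (tl xs)"

lemma windows_coverD:
  assumes "windows_cover r m xs" "i < m"
  shows "{(0, 0), (0, 1), (1, 0), (1, 1)} \<subseteq> set (zip r (drop i xs))"
  using assms
proof (induction m arbitrary: i xs)
  case (Suc m)
  then show ?case by (cases i) (auto simp: drop_Suc)
qed simp

text \<open>The prefix is reversed because \<open>a\<close> falls as \<open>n - a\<close> rises:
  entry \<open>i\<close> of the window starting at \<open>n - 16\<close> belongs to
  \<open>a = 16 - i\<close>. There are 390 = 406 - 16 windows, ending at 16 to 405.\<close>

lemma ajX_17_windows: "windows_cover (rev (take 17 (ajX 9))) 390 (ajX 17)"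
  by code_simp

lemma all_pairs_base:
  assumes "16 \<le> n" "n < 406"
  shows "all_pairs n"
proof -
  let ?z = "zip (rev (take 17 (ajX 9))) (drop (n - 16) (ajX 17))"
  have len: "length (ajX 9) = 19" by (simp add: ajX_9)
  have "set ?z \<subseteq> (\<lambda>a. (aj a, aj (n - a))) ` {..16}"
  proof
    fix p assume "p \<in> set ?z"
    then obtain i where i: "i < 17"
      "p = (rev (take 17 (ajX 9)) ! i, drop (n - 16) (ajX 17) ! i)"
      using len by (auto simp: set_zip)
    have "rev (take 17 (ajX 9)) ! i = ajX 9 ! (16 - i)"
      using i len by (simp add: rev_nth)
    also have "\<dots> = aj (16 - i)"
      using len by (intro aj_eq_ajX_nth[symmetric]) simp
    finally have 1: "rev (take 17 (ajX 9)) ! i = aj (16 - i)" .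
    have "drop (n - 16) (ajX 17) ! i = ajX 17 ! (n - (16 - i))"
      using i assms length_ajX_17 by simp
    also have "\<dots> = aj (n - (16 - i))"
      using i assms length_ajX_17 by (intro aj_eq_ajX_nth[symmetric]) simp
    finally show "p \<in> (\<lambda>a. (aj a, aj (n - a))) ` {..16}"
      using i 1 by auto
  qed
  moreover have "{(0, 0), (0, 1), (1, 0), (1, 1)} \<subseteq> set ?z"
    using assms by (intro windows_coverD[OF ajX_17_windows]) simp
  ultimately show ?thesis unfolding all_pairs_def by (rule subset_trans[rotated])
qed

lemma between_lengths:
  assumes "length (ajX m) \<le> n"
  shows "\<exists>k\<ge>m. length (ajX k) \<le> n \<and> n < length (ajX (Suc k))"
proof -
  have "\<not> n < length (ajX m)" using assms by simp
  moreover have "n < length (ajX (m + (n + 2)))"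
    using length_ajX_gt[of n] length_ajX_mono[of "n + 2" "m + (n + 2)"] by simp
  ultimately obtain d where "\<not> n < length (ajX (m + d))" "n < length (ajX (m + Suc d))"
    using ex_least_nat_less[of "\<lambda>d. n < length (ajX (m + d))" "n + 2"] by auto
  then show ?thesis by (intro exI[of _ "m + d"]) auto
qed

lemma all_pairs_ge_16: "16 \<le> n \<Longrightarrow> all_pairs n"
proof (induction n rule: less_induct)
  case (less n)
  show ?case
  proof (cases "n < 406")
    case True
    then show ?thesis using less.prems by (rule all_pairs_base[rotated])
  next
    case False
    then obtain k' where k': "17 \<le> k'" "length (ajX k') \<le> n" "n < length (ajX (Suc k'))"
      using between_lengths[of 17 n] length_ajX_17 by auto
    \<comment> \<open>The border has index \<open>m + 8\<close> and moves down by 6 to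
      \<open>m + 2\<close>, behind which stands the complement of \<open>ajX m\<close>. Since 17 = 9
      + 8, \<open>ajX m\<close> has at least 19 letters, enough for the offsets below 16.\<close>
    define m where "m = k' - 8"
    let ?L = "\<lambda>k. length (ajX k)"
    have m: "9 \<le> m" "k' = m + 8" using k'(1) by (auto simp: m_def)
    have L: "?L (m + 9) = ?L (m + 8) + ?L (m + 6)"
      using length_ajX_Suc3[of "m + 6"] by (simp add: add.commute)
    define j where "j = n - ?L (m + 8)"
    have j: "n = ?L (m + 8) + j" "j < ?L (m + 6)"
      using k' m L by (auto simp: j_def add.commute)
    have big: "19 \<le> ?L i" if "9 \<le> i" for i
      using length_ajX_mono[OF that] by (simp add: ajX_9)
    show ?thesis
    proof (cases "16 \<le> j")
      case True
      have "aj (n - a) = 1 - aj (j - a)" if "a \<le> 16" for a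
        using aj_shift[of "j - a" "m + 6"] j True that by (simp add: ac_simps)
      moreover have "j < n" using j(1) m big[of "m + 8"] by linarith
      ultimately show ?thesis using less.IH[OF _ True] by (intro all_pairs_compl[of n j])
    next
      case False
      have "aj (n - a) = aj (?L (m + 2) + j - a)" if "a \<le> 16" for a
      proof (cases "a \<le> j")
        \<comment> \<open>Behind the border: both letters are the complement of
          \<open>aj (j - a)\<close>.\<close>
        case True
        then show ?thesis
          using aj_shift[of "j - a" "m + 6"] aj_shift[of "j - a" m] big[of m] m False j
          by (simp add: ac_simps)
      next
        \<comment> \<open>Before the border: both letters stand \<open>a - j\<close> places ahead of
          borders whose indices differ by 6.\<close>
        case False
        then show ?thesis
          using aj_before_border_period[of "a - j" "m + 2"] big[of "m + 2"] m j that
          by (simp add: ac_simps)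
      qed
      moreover have "all_pairs (?L (m + 2) + j)"
      proof (rule less.IH)
        \<comment> \<open>This makes the descent strict: the length grows by at least 19 between
          indices \<open>m + 2\<close> and \<open>m + 5\<close>.\<close>
        have "?L (m + 5) = ?L (m + 4) + ?L (m + 2)"
          using length_ajX_Suc3[of "m + 2"] by (simp add: numeral_eq_Suc del: ajX.simps)
        then show "?L (m + 2) + j < n"
          using j(1) big[of "m + 4"] length_ajX_mono[of "m + 5" "m + 8"] m by linarith
        show "16 \<le> ?L (m + 2) + j" using big[of "m + 2"] m by linarith
      qed
      ultimately show ?thesis by (rule all_pairs_cong)
    qed
  qed
qed

text \<open>Below 16 the full window does not fit, so these sums are found by evaluation; both
  summands index into \<open>ajX 9\<close>.\<close>

lemma small_sums:
  "list_all (\<lambda>n. list_ex (\<lambda>a. ajX 9 ! a = 0 \<and> ajX 9 ! (n - a) = 0) [0..<Suc n]) [10..<16]"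
  "list_all (\<lambda>n. list_ex (\<lambda>a. ajX 9 ! a = 1 \<and> ajX 9 ! (n - a) = 1) [0..<Suc n]) [2..<16]"
  by code_simp+

lemma sum_of_two:
  assumes "i = 0 \<and> 10 \<le> n \<or> i = 1 \<and> 2 \<le> n"
  shows "\<exists>a\<in>J i. \<exists>b\<in>J i. n = a + b"
proof -
  have "\<exists>a\<le>n. aj a = i \<and> aj (n - a) = i"
  proof (cases "16 \<le> n")
    case True
    then have "(i, i) \<in> (\<lambda>a. (aj a, aj (n - a))) ` {..16}"
      using all_pairs_ge_16[OF True] assms unfolding all_pairs_def by auto
    then obtain a where "a \<le> 16" "aj a = i" "aj (n - a) = i" by auto
    then show ?thesis using True by (intro exI[of _ a]) simp
  next
    case False
    then have "i = 0 \<and> n \<in> set [10..<16] \<or> i = 1 \<and> n \<in> set [2..<16]"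
      using assms unfolding set_upt by simp
    then have "\<exists>a\<in>set [0..<Suc n]. ajX 9 ! a = i \<and> ajX 9 ! (n - a) = i"
      using small_sums unfolding list_all_iff list_ex_iff by blast
    then obtain a where "a \<le> n" "ajX 9 ! a = i" "ajX 9 ! (n - a) = i"
      unfolding set_upt by (meson atLeastLessThan_iff less_Suc_eq_le)
    moreover have "aj b = ajX 9 ! b" if "b \<le> n" for b
      using that False by (intro aj_eq_ajX_nth) (simp add: ajX_9)
    ultimately show ?thesis by auto
  qed
  then obtain a where "a \<le> n" "aj a = i" "aj (n - a) = i" by blast
  then show ?thesis
    by (intro bexI[of _ a] bexI[of _ "n - a"]) (auto simp: J_def)
qed

theorem theorem43:
  shows "(\<forall>n\<ge>10. \<exists>a\<in>J 0. \<exists>b\<in>J 0. n = a + b) \<and>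
         (\<forall>n\<ge>2. \<exists>a\<in>J 1. \<exists>b\<in>J 1. n = a + b)"
  using sum_of_two by blast

end
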